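(* Let $n\geqslant 3$ and let $\alpha=(\alpha_1,\ldots,\alpha_n)\in\mathbb{R}^n$ be a vector whose coordinates are algebraically independent over $\mathbb{Q}$. Then $\operatorname{rank}_+ D(\alpha)\geqslant 2\sqrt{n}-2$.
   Context: For $\alpha\in\mathbb{R}^n$, the Euclidean distance matrix $D(\alpha)$ is the $n\times n$ matrix with entries $D_{ij}=(\alpha_i-\alpha_j)^2$. For a real matrix $A$ with nonnegative entries, the nonnegative rank $\operatorname{rank}_+(A)$ is the smallest integer $k$ such that $A$ can be written as a sum of $k$ nonnegative matrices of rank one. *)

theory Defs
  imports "HOL-Analysis.Analysis"
begin

text \<open>An n-vector is a function nat => real, of which only indices i < n matter.
  An n x n matrix is a function nat => nat => real, of which only i, j < n matter.\<close>

definition edm :: "(nat \<Rightarrow> real) \<Rightarrow> nat \<Rightarrow> nat \<Rightarrow> real" where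
  "edm \<alpha> i j = (\<alpha> i - \<alpha> j)^2"

text \<open>Algebraic independence of alpha_0,...,alpha_(n-1) over Q: no nontrivial polynomial
  relation with rational coefficients. A polynomial is given by a finite set M of
  exponent vectors (supported on indices < n) and rational coefficients c.\<close>

definition alg_indep_rat :: "nat \<Rightarrow> (nat \<Rightarrow> real) \<Rightarrow> bool" where
  "alg_indep_rat n \<alpha> \<longleftrightarrow>
     (\<forall>M :: (nat \<Rightarrow> nat) set. \<forall>c :: (nat \<Rightarrow> nat) \<Rightarrow> rat.
        finite M \<longrightarrow> (\<forall>e\<in>M. \<forall>i\<ge>n. e i = 0) \<longrightarrow>
        (\<Sum>e\<in>M. of_rat (c e) * (\<Prod>i<n. \<alpha> i ^ e i)) = 0 \<longrightarrow>
        (\<forall>e\<in>M. c e = 0))"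

definition nonneg_fact :: "nat \<Rightarrow> nat \<Rightarrow> (nat \<Rightarrow> nat \<Rightarrow> real) \<Rightarrow> nat \<Rightarrow> bool" where
  "nonneg_fact n m A k \<longleftrightarrow>
     (\<exists>u v :: nat \<Rightarrow> nat \<Rightarrow> real.
        (\<forall>l<k. \<forall>i<n. u l i \<ge> 0) \<and> (\<forall>l<k. \<forall>j<m. v l j \<ge> 0) \<and>
        (\<forall>i<n. \<forall>j<m. A i j = (\<Sum>l<k. u l i * v l j)))"

definition nonneg_rank :: "nat \<Rightarrow> nat \<Rightarrow> (nat \<Rightarrow> nat \<Rightarrow> real) \<Rightarrow> nat" where
  "nonneg_rank n m A = (LEAST k. nonneg_fact n m A k)"

end

theory Submission
  imports Defs
begin

text \<open>Let \<open>D(\<alpha>) = \<Sum>l<k. u l (v l)\<^sup>T\<close> be a nonnegative factorization. The zero diagonal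
  forces \<open>u l i * v l i = 0\<close> for all \<open>l\<close> and \<open>i\<close>. Choose a maximal independent family
  \<open>u p\<close>, \<open>p \<in> P\<close>, among the vectors \<open>u l\<close>, and let \<open>r\<close> be its size. Write the
  other \<open>u l\<close>, and the functions \<open>\<alpha>\<close> and \<open>\<alpha>\<^sup>2\<close> of the index, in this basis; after
  rescaling, the constant function is a sum of some of the \<open>u l\<close>. This takes
  \<open>r * (k - r) + 2 * r\<close> real parameters. For each \<open>i\<close>, the point \<open>(u p i)\<close>, \<open>p \<in> P\<close>,
  solves the homogeneous system saying that the coordinates \<open>l\<close> with \<open>v l i \<noteq> 0\<close> vanish.
  This system is defined over the ring generated by the parameters, so it also has a suitable
  solution in that ring, and every solution yields a quadratic equation for \<open>\<alpha> i\<close> over that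
  ring. Hence \<open>n \<le> r * (k + 2 - r) \<le> (k + 2)\<^sup>2 / 4\<close>.\<close>

section \<open>Algebraic independence and a dimension count\<close>

text \<open>All dimension comparisons take place over the rationals, with the reals as ambient
  space.\<close>

interpretation rat: vector_space "\<lambda>(q::rat) (x::real). of_rat q * x"
  by unfold_locales (auto simp: algebra_simps of_rat_add of_rat_mult)

text \<open>By bilinearity it suffices to multiply generators. Leaving \<open>U\<close> free lets
  the degree bounds of \<open>S\<close> and \<open>T\<close> add up in applications.\<close>

lemma rat_span_mult:
  assumes x: "x \<in> rat.span S" and y: "y \<in> rat.span T"
    and ST: "\<And>s t. s \<in> S \<Longrightarrow> t \<in> T \<Longrightarrow> s * t \<in> rat.span U"
  shows "x * y \<in> rat.span U"
proof -
  have left: "s * y \<in> rat.span U" if "s \<in> S" for s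
    using y
  proof (induction rule: rat.span_induct_alt)
    case base
    show ?case by (simp add: rat.span_zero)
  next
    case (step c t z)
    have "s * (of_rat c * t + z) = of_rat c * (s * t) + s * z"
      by (simp add: algebra_simps)
    then show ?case
      using step ST[OF that] by (simp add: rat.span_add rat.span_scale)
  qed
  show ?thesis
    using x
  proof (induction rule: rat.span_induct_alt)
    case base
    show ?case by (simp add: rat.span_zero)
  next
    case (step c s z)
    have "(of_rat c * s + z) * y = of_rat c * (s * y) + z * y"
      by (simp add: algebra_simps)
    then show ?case
      using step left by (simp add: rat.span_add rat.span_scale)
  qed
qed

section \<open>Rational polynomial expressions, filtered by degree\<close>

text \<open>The bound \<open>d\<close> applies to each variable separately, and exponents are
  extensional functions; so for finite \<open>I\<close> there are at most
  \<open>(d + 1) ^ card I\<close> values.\<close>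

definition monomials :: "('i \<Rightarrow> real) \<Rightarrow> 'i set \<Rightarrow> nat \<Rightarrow> real set" where
  "monomials y I d = (\<lambda>f. \<Prod>j\<in>I. y j ^ f j) ` (I \<rightarrow>\<^sub>E {..d})"

text \<open>For finite \<open>I\<close> this is the ring generated over the rationals by the
  \<open>y j\<close>. The filtration by \<open>d\<close> is kept because the dimension count needs
  explicit degrees.\<close>

definition rat_polys :: "('i \<Rightarrow> real) \<Rightarrow> 'i set \<Rightarrow> real set" where
  "rat_polys y I = (\<Union>d. rat.span (monomials y I d))"

lemma monomialsI:
  assumes "\<And>j. j \<in> I \<Longrightarrow> f j \<le> d"
  shows "(\<Prod>j\<in>I. y j ^ f j) \<in> monomials y I d"
  unfolding monomials_def
proof (rule image_eqI)
  show "(\<Prod>j\<in>I. y j ^ f j) = (\<Prod>j\<in>I. y j ^ restrict f I j)"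
    by (rule prod.cong) auto
qed (use assms in auto)

lemma monomials_mult:
  assumes "s \<in> monomials y I d" "t \<in> monomials y I d'"
  shows "s * t \<in> monomials y I (d + d')"
proof -
  obtain f g where f: "f \<in> I \<rightarrow>\<^sub>E {..d}" "s = (\<Prod>j\<in>I. y j ^ f j)"
    and g: "g \<in> I \<rightarrow>\<^sub>E {..d'}" "t = (\<Prod>j\<in>I. y j ^ g j)"
    using assms unfolding monomials_def by blast
  have "s * t = (\<Prod>j\<in>I. y j ^ (f j + g j))"
    by (simp add: f g power_add prod.distrib)
  also have "\<dots> \<in> monomials y I (d + d')"
    using f(1) g(1) by (intro monomialsI add_mono) (auto simp: PiE_iff)
  finally show ?thesis .
qed

lemma monomials_mono: "d \<le> d' \<Longrightarrow> monomials y I d \<subseteq> monomials y I d'"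
  unfolding monomials_def by (intro image_mono PiE_mono) auto

lemma span_monomials_mult:
  assumes "x \<in> rat.span (monomials y I d)" "z \<in> rat.span (monomials y I d')"
  shows "x * z \<in> rat.span (monomials y I (d + d'))"
  using assms by (rule rat_span_mult) (simp add: monomials_mult rat.span_base)

lemma span_monomials_mono:
  "d \<le> d' \<Longrightarrow> rat.span (monomials y I d) \<subseteq> rat.span (monomials y I d')"
  by (intro rat.span_mono monomials_mono)

lemma one_in_span_monomials: "1 \<in> rat.span (monomials y I d)"
  using monomialsI[of I "\<lambda>_. 0" d y] by (simp add: rat.span_base)

lemma rat_polys_0: "0 \<in> rat_polys y I"
  by (auto simp: rat_polys_def rat.span_zero)

lemma rat_polys_1: "1 \<in> rat_polys y I"
  by (auto simp: rat_polys_def one_in_span_monomials)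

lemma rat_polys_uminus: "x \<in> rat_polys y I \<Longrightarrow> - x \<in> rat_polys y I"
  unfolding rat_polys_def using rat.span_neg by blast

lemma rat_polys_add:
  assumes "x \<in> rat_polys y I" "z \<in> rat_polys y I"
  shows "x + z \<in> rat_polys y I"
proof -
  obtain d d' where "x \<in> rat.span (monomials y I d)" "z \<in> rat.span (monomials y I d')"
    using assms unfolding rat_polys_def by blast
  then have "x \<in> rat.span (monomials y I (d + d'))" "z \<in> rat.span (monomials y I (d + d'))"
    using span_monomials_mono[of d "d + d'" y I] span_monomials_mono[of d' "d + d'" y I] by auto
  then show ?thesis
    unfolding rat_polys_def using rat.span_add by blast
qed

lemma rat_polys_mult:
  assumes "x \<in> rat_polys y I" "z \<in> rat_polys y I"
  shows "x * z \<in> rat_polys y I"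
proof -
  obtain d d' where "x \<in> rat.span (monomials y I d)" "z \<in> rat.span (monomials y I d')"
    using assms unfolding rat_polys_def by blast
  then have "x * z \<in> rat.span (monomials y I (d + d'))"
    by (rule span_monomials_mult)
  then show ?thesis
    unfolding rat_polys_def by blast
qed

lemma rat_polys_sum: "(\<And>p. p \<in> P \<Longrightarrow> f p \<in> rat_polys y I) \<Longrightarrow> sum f P \<in> rat_polys y I"
  by (induction P rule: infinite_finite_induct) (simp_all add: rat_polys_0 rat_polys_add)

lemma rat_polys_var:
  assumes "finite I" "i \<in> I"
  shows "y i \<in> rat_polys y I"
proof -
  have "(\<Prod>j\<in>I. y j ^ (if j = i then 1 else 0)) \<in> monomials y I 1"
    by (rule monomialsI) auto
  moreover have "(\<Prod>j\<in>I. y j ^ (if j = i then 1 else 0)) = (\<Prod>j\<in>I. if j = i then y j else 1)"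
    by (rule prod.cong) auto
  ultimately have "y i \<in> monomials y I 1"
    using assms by (simp add: prod.delta)
  then show ?thesis
    unfolding rat_polys_def using rat.span_base by blast
qed

section \<open>Reduction of powers modulo quadratic equations\<close>

text \<open>Each factor \<open>A\<close> pays for one replacement of
  \<open>A * \<alpha>\<^sup>2\<close> by \<open>B * \<alpha> + C\<close>. The same power
  \<open>A ^ N\<close> serves every exponent up to \<open>N\<close>, and the degree in
  \<open>y\<close> grows only linearly in \<open>N\<close>.\<close>

lemma quadratic_power_reduction:
  fixes \<alpha> A B C :: real
  assumes A: "A \<in> rat.span (monomials y I d)" and B: "B \<in> rat.span (monomials y I d)"
    and C: "C \<in> rat.span (monomials y I d)"
    and quad: "A * \<alpha>\<^sup>2 = B * \<alpha> + C" and "e \<le> N"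
  shows "\<exists>B'\<in>rat.span (monomials y I (N * d)). \<exists>C'\<in>rat.span (monomials y I (N * d)).
           A ^ N * \<alpha> ^ e = B' * \<alpha> + C'"
  using \<open>e \<le> N\<close>
proof (induction N arbitrary: e)
  case 0
  show ?case
    by (rule bexI[of _ 0], rule bexI[of _ 1])
       (use 0 in \<open>auto simp: rat.span_zero one_in_span_monomials\<close>)
next
  case (Suc N)
  show ?case
  proof (cases e)
    case 0
    obtain B' C' where "B' \<in> rat.span (monomials y I (N * d))" "C' \<in> rat.span (monomials y I (N * d))"
      "A ^ N * \<alpha> ^ 0 = B' * \<alpha> + C'"
      using Suc.IH[of 0] by auto
    note IH = this
    show ?thesis
    proof (intro bexI)
      show "A ^ Suc N * \<alpha> ^ e = (A * B') * \<alpha> + A * C'"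
        using IH(3) 0 by (simp add: algebra_simps)
    qed (use span_monomials_mult[OF A IH(1)] span_monomials_mult[OF A IH(2)] in auto)
  next
    case (Suc e')
    with Suc.prems have "e' \<le> N" by simp
    then obtain B' C' where "B' \<in> rat.span (monomials y I (N * d))"
      "C' \<in> rat.span (monomials y I (N * d))" "A ^ N * \<alpha> ^ e' = B' * \<alpha> + C'"
      using Suc.IH[of e'] by auto
    note IH = this
    show ?thesis
    proof (intro bexI)
      have "A ^ Suc N * \<alpha> ^ e = A * \<alpha> * (A ^ N * \<alpha> ^ e')"
        using Suc by simp
      also have "\<dots> = B' * (A * \<alpha>\<^sup>2) + A * C' * \<alpha>"
        by (simp only: IH(3)) (simp add: algebra_simps power2_eq_square)
      also have "\<dots> = (B * B' + A * C') * \<alpha> + C * B'"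
        by (simp only: quad) (simp add: algebra_simps)
      finally show "A ^ Suc N * \<alpha> ^ e = (B * B' + A * C') * \<alpha> + C * B'" .
    qed (use span_monomials_mult[OF B IH(1)] span_monomials_mult[OF A IH(2)]
          span_monomials_mult[OF C IH(1)] in \<open>auto intro: rat.span_add\<close>)
  qed
qed

text \<open>Squarefree in \<alpha>: after reduction each \<open>\<alpha> i\<close> occurs at most
  once, which costs a factor \<open>2 ^ n\<close> independent of the degree
  \<open>d\<close>.\<close>

definition mixed_monomials ::
    "(nat \<Rightarrow> real) \<Rightarrow> ('i \<Rightarrow> real) \<Rightarrow> 'i set \<Rightarrow> nat \<Rightarrow> nat \<Rightarrow> real set" where
  "mixed_monomials \<alpha> y I d n =
     (\<lambda>(s, E). s * (\<Prod>i\<in>E. \<alpha> i)) ` (monomials y I d \<times> Pow {..<n})"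

lemma mixed_monomialsI:
  "s \<in> monomials y I d \<Longrightarrow> E \<subseteq> {..<n} \<Longrightarrow> s * (\<Prod>i\<in>E. \<alpha> i) \<in> mixed_monomials \<alpha> y I d n"
  unfolding mixed_monomials_def by (rule image_eqI[of _ _ "(s, E)"]) auto

lemma finite_mixed_monomials: "finite I \<Longrightarrow> finite (mixed_monomials \<alpha> y I d n)"
  unfolding mixed_monomials_def monomials_def by (intro finite_imageI finite_SigmaI finite_PiE) auto

lemma card_mixed_monomials:
  assumes "finite I"
  shows "card (mixed_monomials \<alpha> y I d n) \<le> (d + 1) ^ card I * 2 ^ n"
proof -
  have fin: "finite (monomials y I d)"
    unfolding monomials_def using assms by (intro finite_imageI finite_PiE) auto
  have "card (mixed_monomials \<alpha> y I d n) \<le> card (monomials y I d) * 2 ^ n"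
    unfolding mixed_monomials_def
    using card_image_le[of "monomials y I d \<times> Pow {..<n}" "\<lambda>(s, E). s * (\<Prod>i\<in>E. \<alpha> i)"] fin
    by (simp add: card_cartesian_product card_Pow)
  also have "card (monomials y I d) \<le> (d + 1) ^ card I"
    unfolding monomials_def
    using card_image_le[of "I \<rightarrow>\<^sub>E {..d}"] assms
    by (simp add: finite_PiE card_PiE)
  finally show ?thesis by simp
qed

text \<open>Expanding the product selects from each factor either the term with
  \<open>\<alpha> i\<close> or the term without it; the \<open>n\<close> coefficient degrees add up
  to \<open>n * D\<close>.\<close>

lemma prod_linear_in_span_mixed_monomials:
  assumes "\<And>i. i < n \<Longrightarrow> B i \<in> rat.span (monomials y I D)"
    and "\<And>i. i < n \<Longrightarrow> C i \<in> rat.span (monomials y I D)"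
  shows "(\<Prod>i<n. B i * \<alpha> i + C i) \<in> rat.span (mixed_monomials \<alpha> y I (n * D) n)"
  using assms
proof (induction n)
  case 0
  have "1 * (\<Prod>i\<in>{}. \<alpha> i) \<in> mixed_monomials \<alpha> y I 0 0"
    using monomialsI[of I "\<lambda>_. 0" 0 y] by (intro mixed_monomialsI) auto
  then show ?case by (simp add: rat.span_base)
next
  case (Suc n)
  let ?U = "mixed_monomials \<alpha> y I (Suc n * D) (Suc n)"
  let ?x = "\<Prod>i<n. B i * \<alpha> i + C i"
  have x: "?x \<in> rat.span (mixed_monomials \<alpha> y I (n * D) n)"
    by (rule Suc.IH) (use Suc.prems in auto)
  have s: "s * t \<in> rat.span ?U \<and> s * (t * \<alpha> n) \<in> rat.span ?U"
    if smem: "s \<in> mixed_monomials \<alpha> y I (n * D) n" and tmem: "t \<in> monomials y I D" for s t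
  proof -
    obtain s' E where s': "s' \<in> monomials y I (n * D)" "E \<subseteq> {..<n}" "s = s' * (\<Prod>i\<in>E. \<alpha> i)"
      using smem unfolding mixed_monomials_def by auto
    have st: "s' * t \<in> monomials y I (Suc n * D)"
      using monomials_mult[OF s'(1) tmem] by (simp add: add.commute)
    have "finite E" "n \<notin> E"
      using s'(2) finite_subset by auto
    then have "s * (t * \<alpha> n) = s' * t * (\<Prod>i\<in>insert n E. \<alpha> i)"
      by (simp add: s'(3))
    moreover have "s * t = s' * t * (\<Prod>i\<in>E. \<alpha> i)"
      by (simp add: s'(3))
    moreover have "insert n E \<subseteq> {..<Suc n}" "E \<subseteq> {..<Suc n}"
      using s'(2) by auto
    then have "s' * t * (\<Prod>i\<in>insert n E. \<alpha> i) \<in> ?U" "s' * t * (\<Prod>i\<in>E. \<alpha> i) \<in> ?U"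
      using mixed_monomialsI[OF st] by blast+
    ultimately show ?thesis
      by (metis rat.span_base)
  qed
  have "?x * C n \<in> rat.span ?U"
    by (rule rat_span_mult[OF x Suc.prems(2)]) (use s in auto)
  moreover have "?x * (B n * \<alpha> n) \<in> rat.span ?U"
  proof (rule rat_span_mult[OF x])
    show "B n * \<alpha> n \<in> rat.span ((\<lambda>t. t * \<alpha> n) ` monomials y I D)"
      by (rule rat_span_mult[OF Suc.prems(1)[OF lessI], where T = "{\<alpha> n}"])
         (auto intro!: rat.span_base)
  qed (use s in auto)
  ultimately have "?x * (B n * \<alpha> n) + ?x * C n \<in> rat.span ?U"
    by (rule rat.span_add[rotated])
  then show ?case
    by (simp add: distrib_left)
qed

section \<open>Monomials in algebraically independent numbers\<close>

text \<open>Exponents vanish beyond \<open>n\<close>, as \<open>alg_indep_rat\<close> demands,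
  whereas extensional functions are \<open>undefined\<close> there; a bijection between the two
  gives the count.\<close>

definition bounded_exps :: "nat \<Rightarrow> nat \<Rightarrow> (nat \<Rightarrow> nat) set" where
  "bounded_exps n N = {e. (\<forall>i<n. e i \<le> N) \<and> (\<forall>i\<ge>n. e i = 0)}"

lemma bounded_exps_bij:
  "bij_betw (\<lambda>e. restrict e {..<n}) (bounded_exps n N) ({..<n} \<rightarrow>\<^sub>E {..N})"
proof (rule bij_betw_byWitness[where f' = "\<lambda>f i. if i < n then f i else 0"])
  show "\<forall>e\<in>bounded_exps n N. (\<lambda>i. if i < n then restrict e {..<n} i else 0) = e"
    by (simp add: bounded_exps_def fun_eq_iff)
  show "\<forall>f\<in>{..<n} \<rightarrow>\<^sub>E {..N}. restrict (\<lambda>i. if i < n then f i else 0) {..<n} = f"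
  proof (intro ballI ext)
    fix f i assume f: "f \<in> {..<n} \<rightarrow>\<^sub>E {..N}"
    show "restrict (\<lambda>i. if i < n then f i else 0) {..<n} i = f i"
      using PiE_arb[OF f, of i] by simp
  qed
  show "(\<lambda>e. restrict e {..<n}) ` bounded_exps n N \<subseteq> {..<n} \<rightarrow>\<^sub>E {..N}"
    by (rule image_subsetI) (simp add: bounded_exps_def)
  show "(\<lambda>f i. if i < n then f i else 0) ` ({..<n} \<rightarrow>\<^sub>E {..N}) \<subseteq> bounded_exps n N"
    by (rule image_subsetI) (auto simp: bounded_exps_def dest: PiE_mem)
qed

lemma finite_bounded_exps: "finite (bounded_exps n N)"
  using bij_betw_finite[OF bounded_exps_bij[of n N]] by (simp add: finite_PiE)

lemma card_bounded_exps: "card (bounded_exps n N) = (N + 1) ^ n"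
  using bij_betw_same_card[OF bounded_exps_bij[of n N]] by (simp add: card_PiE)

lemma alg_indep_ratD:
  assumes "alg_indep_rat n \<alpha>" "finite M" "\<And>e i. e \<in> M \<Longrightarrow> i \<ge> n \<Longrightarrow> e i = 0"
    and "(\<Sum>e\<in>M. of_rat (c e) * (\<Prod>i<n. \<alpha> i ^ e i)) = 0" and "e \<in> M"
  shows "c e = 0"
  using assms(1)[unfolded alg_indep_rat_def, THEN spec, THEN spec, of M c] assms(2-) by simp

text \<open>Two equal monomials with different exponents would give a relation with coefficients 1
  and -1.\<close>

lemma alg_indep_rat_monomials_inj:
  assumes "alg_indep_rat n \<alpha>" and "\<forall>i\<ge>n. e i = 0" "\<forall>i\<ge>n. e' i = 0"
    and eq: "(\<Prod>i<n. \<alpha> i ^ e i) = (\<Prod>i<n. \<alpha> i ^ e' i)"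
  shows "e = e'"
proof (rule ccontr)
  assume ne: "e \<noteq> e'"
  let ?c = "\<lambda>f. if f = e then 1 else - 1 :: rat"
  have "(\<Sum>f\<in>{e, e'}. of_rat (?c f) * (\<Prod>i<n. \<alpha> i ^ f i)) = 0"
    using ne eq by (simp add: of_rat_minus)
  then have "?c e = 0"
    by (rule alg_indep_ratD[OF assms(1), rotated 2]) (use assms(2,3) in auto)
  then show False by simp
qed

lemma alg_indep_rat_inj:
  assumes "alg_indep_rat n \<alpha>" "a < n" "b < n" "a \<noteq> b"
  shows "\<alpha> a \<noteq> \<alpha> b"
proof
  assume eq: "\<alpha> a = \<alpha> b"
  have unit: "(\<Prod>i<n. \<alpha> i ^ (if i = c then 1 else 0)) = \<alpha> c" if "c < n" for c
  proof -
    have "(\<Prod>i<n. \<alpha> i ^ (if i = c then 1 else 0)) = (\<Prod>i<n. if i = c then \<alpha> i else 1)"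
      by (rule prod.cong) auto
    then show ?thesis using that by (simp add: prod.delta)
  qed
  have "(\<lambda>i. if i = a then 1 else 0) = (\<lambda>i. if i = b then 1 else 0 :: nat)"
    by (rule alg_indep_rat_monomials_inj[OF assms(1)]) (use assms eq unit in auto)
  from fun_cong[OF this, of a] show False
    using assms(4) by simp
qed

text \<open>Up to a common nonzero factor, the \<open>(N + 1) ^ n\<close> rationally independent monomials
  in \<open>\<alpha>\<close> with exponents at most \<open>N\<close> lie in a space of dimension \<open>O(N ^ card I)\<close>.\<close>

lemma alg_indep_rat_le_card:
  assumes indep: "alg_indep_rat n \<alpha>" and "finite I"
    and quad: "\<And>i. i < n \<Longrightarrow> \<exists>A\<in>rat_polys y I. \<exists>B\<in>rat_polys y I. \<exists>C\<in>rat_polys y I.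
                 A \<noteq> 0 \<and> A * (\<alpha> i)\<^sup>2 = B * \<alpha> i + C"
  shows "n \<le> card I"
proof (rule ccontr)
  assume "\<not> n \<le> card I"
  then have lt: "Suc (card I) \<le> n" by simp
  define reduces where "reduces i A B C d \<longleftrightarrow> A \<noteq> 0 \<and> A * (\<alpha> i)\<^sup>2 = B * \<alpha> i + C
      \<and> A \<in> rat.span (monomials y I d) \<and> B \<in> rat.span (monomials y I d)
      \<and> C \<in> rat.span (monomials y I d)" for i A B C d
  have "\<exists>A B C d. reduces i A B C d" if "i < n" for i
  proof -
    obtain A B C a b c where "A \<noteq> 0" "A * (\<alpha> i)\<^sup>2 = B * \<alpha> i + C"
      "A \<in> rat.span (monomials y I a)" "B \<in> rat.span (monomials y I b)"
      "C \<in> rat.span (monomials y I c)"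
      using quad[OF \<open>i < n\<close>] unfolding rat_polys_def by blast
    moreover have "rat.span (monomials y I a) \<subseteq> rat.span (monomials y I (a + b + c))"
      "rat.span (monomials y I b) \<subseteq> rat.span (monomials y I (a + b + c))"
      "rat.span (monomials y I c) \<subseteq> rat.span (monomials y I (a + b + c))"
      by (intro span_monomials_mono; simp)+
    ultimately have "reduces i A B C (a + b + c)"
      unfolding reduces_def by blast
    then show ?thesis by blast
  qed
  then obtain A B C d where "\<And>i. i < n \<Longrightarrow> reduces i (A i) (B i) (C i) (d i)"
    by metis
  then have A0: "\<And>i. i < n \<Longrightarrow> A i \<noteq> 0"
    and q: "\<And>i. i < n \<Longrightarrow> A i * (\<alpha> i)\<^sup>2 = B i * \<alpha> i + C i"
    and ABC: "\<And>i. i < n \<Longrightarrow> A i \<in> rat.span (monomials y I (d i))"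
      "\<And>i. i < n \<Longrightarrow> B i \<in> rat.span (monomials y I (d i))"
      "\<And>i. i < n \<Longrightarrow> C i \<in> rat.span (monomials y I (d i))"
    unfolding reduces_def by simp_all
  \<comment> \<open>A common degree bound for all \<open>n\<close> quadratic equations.\<close>
  define D where "D = (\<Sum>i<n. d i)"
  have dD: "d i \<le> D" if "i < n" for i
    unfolding D_def using that by (intro member_le_sum) auto
  have ABC': "A i \<in> rat.span (monomials y I D)" "B i \<in> rat.span (monomials y I D)"
      "C i \<in> rat.span (monomials y I D)" if "i < n" for i
    using ABC[OF that] span_monomials_mono[OF dD[OF that], of y I] by auto
  have bound: "(N + 1) ^ n \<le> (n * (N * D) + 1) ^ card I * 2 ^ n" for N
  proof -
    \<comment> \<open>A common denominator: \<open>A i ^ N\<close> makes every power of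
      \<open>\<alpha> i\<close> up to the \<open>N\<close>-th reducible, so one \<open>w\<close>
      serves all exponent vectors.\<close>
    define w where "w = (\<Prod>i<n. A i ^ N)"
    have "w \<noteq> 0" using A0 by (simp add: w_def)
    define g where "g e = w * (\<Prod>i<n. \<alpha> i ^ e i)" for e
    have inj: "inj_on g (bounded_exps n N)"
      using alg_indep_rat_monomials_inj[OF indep] \<open>w \<noteq> 0\<close>
      by (intro inj_onI) (auto simp: g_def bounded_exps_def)
    have "rat.independent (g ` bounded_exps n N)"
    proof (rule rat.independent_if_scalars_zero)
      fix f x
      assume 0: "(\<Sum>x\<in>g ` bounded_exps n N. of_rat (f x) * x) = 0"
        and x: "x \<in> g ` bounded_exps n N"
      have "w * (\<Sum>e\<in>bounded_exps n N. of_rat (f (g e)) * (\<Prod>i<n. \<alpha> i ^ e i)) = 0"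
      proof -
        have "(\<Sum>e\<in>bounded_exps n N. of_rat (f (g e)) * g e) = 0"
          using 0 by (simp add: sum.reindex[OF inj])
        moreover have "of_rat (f (g e)) * g e = w * (of_rat (f (g e)) * (\<Prod>i<n. \<alpha> i ^ e i))" for e
          by (simp add: g_def mult.left_commute)
        ultimately show ?thesis
          by (simp only: sum_distrib_left)
      qed
      then have "(\<Sum>e\<in>bounded_exps n N. of_rat (f (g e)) * (\<Prod>i<n. \<alpha> i ^ e i)) = 0"
        using \<open>w \<noteq> 0\<close> by simp
      then have "f (g e) = 0" if "e \<in> bounded_exps n N" for e
        by (rule alg_indep_ratD[OF indep finite_bounded_exps, rotated 1, OF _ that])
           (simp add: bounded_exps_def)
      then show "f x = 0" using x by auto
    qed (simp add: finite_bounded_exps)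
    moreover have "g ` bounded_exps n N \<subseteq> rat.span (mixed_monomials \<alpha> y I (n * (N * D)) n)"
    proof (rule image_subsetI)
      fix e assume "e \<in> bounded_exps n N"
      then have "\<exists>B'\<in>rat.span (monomials y I (N * D)). \<exists>C'\<in>rat.span (monomials y I (N * D)).
           A i ^ N * \<alpha> i ^ e i = B' * \<alpha> i + C'" if "i < n" for i
        using that by (intro quadratic_power_reduction[OF ABC'[OF that] q[OF that]])
          (auto simp: bounded_exps_def)
      then obtain B' C' where BC: "\<And>i. i < n \<Longrightarrow> B' i \<in> rat.span (monomials y I (N * D))"
        "\<And>i. i < n \<Longrightarrow> C' i \<in> rat.span (monomials y I (N * D))"
        "\<And>i. i < n \<Longrightarrow> A i ^ N * \<alpha> i ^ e i = B' i * \<alpha> i + C' i"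
        by metis
      have "g e = (\<Prod>i<n. A i ^ N * \<alpha> i ^ e i)"
        by (simp add: g_def w_def prod.distrib)
      also have "\<dots> = (\<Prod>i<n. B' i * \<alpha> i + C' i)"
        by (rule prod.cong) (use BC(3) in auto)
      finally show "g e \<in> rat.span (mixed_monomials \<alpha> y I (n * (N * D)) n)"
        using prod_linear_in_span_mixed_monomials[OF BC(1,2)] by simp
    qed
    ultimately have "card (g ` bounded_exps n N) \<le> card (mixed_monomials \<alpha> y I (n * (N * D)) n)"
      using rat.independent_span_bound finite_mixed_monomials[OF \<open>finite I\<close>] by blast
    then show ?thesis
      using card_mixed_monomials[OF \<open>finite I\<close>, of \<alpha> y "n * (N * D)" n]
      by (simp add: card_image[OF inj] card_bounded_exps)
  qed
  \<comment> \<open>Since \<open>n\<close> exceeds \<open>card I\<close>, the left side of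
    \<open>bound\<close> has at least one more factor \<open>N + 1\<close> than the right side has
    growth in \<open>N\<close>; cancelling leaves a constant on the right.\<close>
  have "N + 1 \<le> (n * D + 1) ^ card I * 2 ^ n" for N
  proof -
    have "(N + 1) ^ card I * (N + 1) \<le> (N + 1) ^ n"
      using power_increasing[OF lt, of "N + 1"] by (simp add: mult.commute)
    also have "\<dots> \<le> (n * (N * D) + 1) ^ card I * 2 ^ n"
      by (rule bound)
    also have "\<dots> \<le> ((n * D + 1) * (N + 1)) ^ card I * 2 ^ n"
      by (intro mult_right_mono power_mono) (auto simp: algebra_simps)
    also have "\<dots> = (N + 1) ^ card I * ((n * D + 1) ^ card I * 2 ^ n)"
      by (simp only: power_mult_distrib mult_ac)
    finally show ?thesis
      by (subst (asm) mult_le_cancel1) simp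
  qed
  \<comment> \<open>Taking the constant itself for \<open>N\<close> contradicts its being an upper
    bound for \<open>N + 1\<close>.\<close>
  from this[of "(n * D + 1) ^ card I * 2 ^ n"] show False by simp
qed

section \<open>Linear systems over a subring\<close>

text \<open>Over the fraction field of \<open>A\<close>, the form \<open>g\<close> is no combination
  of the relations satisfied by \<open>x\<close>, so some common zero of these relations has
  \<open>g\<close> nonzero; clearing denominators puts it in \<open>A\<close>. The proof eliminates
  one unknown at a time by cross-multiplication, without forming fractions.\<close>

lemma subring_solution_of_linear_system:
  fixes A :: "'a::idom set"
  assumes A0: "0 \<in> A" and A1: "1 \<in> A"
    and Aadd: "\<And>a b. a \<in> A \<Longrightarrow> b \<in> A \<Longrightarrow> a + b \<in> A"
    and Amult: "\<And>a b. a \<in> A \<Longrightarrow> b \<in> A \<Longrightarrow> a * b \<in> A"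
    and Aneg: "\<And>a. a \<in> A \<Longrightarrow> - a \<in> A"
    and "finite P" and "\<And>p. p \<in> P \<Longrightarrow> g p \<in> A" and "(\<Sum>p\<in>P. g p * x p) \<noteq> 0"
  obtains z where "\<And>p. p \<in> P \<Longrightarrow> z p \<in> A" and "(\<Sum>p\<in>P. g p * z p) \<noteq> 0"
    and "\<And>c. (\<And>p. p \<in> P \<Longrightarrow> c p \<in> A) \<Longrightarrow> (\<Sum>p\<in>P. c p * x p) = 0 \<Longrightarrow> (\<Sum>p\<in>P. c p * z p) = 0"
proof -
  have sum_A: "(\<And>p. p \<in> Q \<Longrightarrow> f p \<in> A) \<Longrightarrow> sum f Q \<in> A" for f :: "'b \<Rightarrow> 'a" and Q
    by (induction Q rule: infinite_finite_induct) (simp_all add: A0 Aadd)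
  have "\<exists>z. (\<forall>p\<in>P. z p \<in> A) \<and> (\<Sum>p\<in>P. g p * z p) \<noteq> 0 \<and>
      (\<forall>c. (\<forall>p\<in>P. c p \<in> A) \<longrightarrow> (\<Sum>p\<in>P. c p * x p) = 0 \<longrightarrow> (\<Sum>p\<in>P. c p * z p) = 0)"
    using assms(6-8)
  proof (induction P arbitrary: g rule: finite_induct)
    case empty
    then show ?case by simp
  next
    case (insert q P)
    show ?case
    proof (cases "\<exists>d. (\<forall>p\<in>insert q P. d p \<in> A) \<and> d q \<noteq> 0 \<and> (\<Sum>p\<in>insert q P. d p * x p) = 0")
      case True
      then obtain d where d: "\<forall>p\<in>insert q P. d p \<in> A" "d q \<noteq> 0"
        "(\<Sum>p\<in>insert q P. d p * x p) = 0" by blast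
      have dq: "d q * x q = - (\<Sum>p\<in>P. d p * x p)"
        using d(3) insert.hyps by (simp add: eq_neg_iff_add_eq_0)
      \<comment> \<open>Cancels the coefficient at \<open>q\<close> by means of \<open>d\<close>. As
        \<open>d\<close> vanishes at \<open>x\<close>, the value of \<open>c\<close> at
        \<open>x\<close> is only multiplied by \<open>d q\<close>.\<close>
      define elim where "elim c p = d q * c p - c q * d p" for c p
      have elim_A: "elim c p \<in> A" if "\<forall>p\<in>insert q P. c p \<in> A" "p \<in> P" for c p
        using Aadd[OF Amult[of "d q" "c p"] Aneg[OF Amult[of "c q" "d p"]]] that d(1)
        by (simp add: elim_def)
      have elim_x: "(\<Sum>p\<in>P. elim c p * x p) = d q * (\<Sum>p\<in>insert q P. c p * x p)" for c
      proof -
        have "(\<Sum>p\<in>P. elim c p * x p) = d q * (\<Sum>p\<in>P. c p * x p) + c q * (- (\<Sum>p\<in>P. d p * x p))"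
          by (simp add: elim_def algebra_simps sum_subtractf sum_distrib_left)
        then show ?thesis
          using insert.hyps by (simp add: dq[symmetric] algebra_simps)
      qed
      have "(\<Sum>p\<in>P. elim g p * x p) \<noteq> 0"
        using insert.prems(2) d(2) by (simp add: elim_x)
      with insert.IH[of "elim g"] elim_A[of g] insert.prems(1) obtain z where
        z: "\<forall>p\<in>P. z p \<in> A" "(\<Sum>p\<in>P. elim g p * z p) \<noteq> 0"
           "\<forall>c. (\<forall>p\<in>P. c p \<in> A) \<longrightarrow> (\<Sum>p\<in>P. c p * x p) = 0 \<longrightarrow> (\<Sum>p\<in>P. c p * z p) = 0"
        by blast
      \<comment> \<open>The value at \<open>q\<close> is forced by requiring \<open>d\<close> to
        vanish at \<open>z'\<close>; scaling the other coordinates by \<open>d q\<close> avoids a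
        division.\<close>
      define z' where "z' p = (if p = q then - (\<Sum>p\<in>P. d p * z p) else d q * z p)" for p
      have z'_sum: "(\<Sum>p\<in>insert q P. c p * z' p) = (\<Sum>p\<in>P. elim c p * z p)" for c
      proof -
        have "(\<Sum>p\<in>P. c p * z' p) = (\<Sum>p\<in>P. c p * (d q * z p))"
          by (rule sum.cong) (use insert.hyps in \<open>auto simp: z'_def\<close>)
        then show ?thesis
          using insert.hyps
          by (simp add: z'_def elim_def algebra_simps sum_subtractf sum_distrib_left)
      qed
      have "z' p \<in> A" if "p \<in> insert q P" for p
        using that d(1) z(1) by (auto simp: z'_def intro!: Aneg sum_A Amult)
      moreover have "(\<Sum>p\<in>insert q P. g p * z' p) \<noteq> 0"
        by (simp only: z'_sum z(2) not_False_eq_True)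
      moreover have "(\<Sum>p\<in>insert q P. c p * z' p) = 0"
        if "\<forall>p\<in>insert q P. c p \<in> A" "(\<Sum>p\<in>insert q P. c p * x p) = 0" for c
      proof -
        have "(\<Sum>p\<in>P. elim c p * x p) = 0"
          by (simp only: elim_x that(2) mult_zero_right)
        then show ?thesis
          using z(3) elim_A[OF that(1)] by (simp only: z'_sum) blast
      qed
      ultimately show ?thesis by blast
    next
      \<comment> \<open>Now no relation over \<open>A\<close> involves \<open>q\<close>, so the
        coordinate at \<open>q\<close> is free: the unit vector at \<open>q\<close> works if
        \<open>g\<close> restricted to \<open>P\<close> vanishes at \<open>x\<close>, and otherwise
        a solution on \<open>P\<close> extends by 0.\<close>
      case False
      then have q0: "c q = 0"
        if "\<forall>p\<in>insert q P. c p \<in> A" "(\<Sum>p\<in>insert q P. c p * x p) = 0" for c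
        using that by blast
      show ?thesis
      proof (cases "(\<Sum>p\<in>P. g p * x p) = 0")
        case True
        then have "g q \<noteq> 0"
          using insert.prems(2) insert.hyps by auto
        moreover have "(\<Sum>p\<in>insert q P. c p * (if p = q then 1 else 0)) = c q" for c :: "'b \<Rightarrow> 'a"
        proof -
          have "(\<Sum>p\<in>P. c p * (if p = q then 1 else 0)) = 0"
            by (rule sum.neutral) (use insert.hyps in auto)
          then show ?thesis using insert.hyps by simp
        qed
        ultimately show ?thesis
          using q0 A0 A1 by (intro exI[of _ "\<lambda>p. if p = q then 1 else 0"]) simp
      next
        case False
        with insert.IH[of g] insert.prems(1) obtain z where
          z: "\<forall>p\<in>P. z p \<in> A" "(\<Sum>p\<in>P. g p * z p) \<noteq> 0"
             "\<forall>c. (\<forall>p\<in>P. c p \<in> A) \<longrightarrow> (\<Sum>p\<in>P. c p * x p) = 0 \<longrightarrow> (\<Sum>p\<in>P. c p * z p) = 0"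
          by blast
        have z'_sum: "(\<Sum>p\<in>insert q P. c p * (z(q := 0)) p) = (\<Sum>p\<in>P. c p * z p)" for c
        proof -
          have "(\<Sum>p\<in>P. c p * (z(q := 0)) p) = (\<Sum>p\<in>P. c p * z p)"
            by (rule sum.cong) (use insert.hyps in auto)
          then show ?thesis using insert.hyps by simp
        qed
        have "(\<Sum>p\<in>P. c p * z p) = 0"
          if "\<forall>p\<in>insert q P. c p \<in> A" "(\<Sum>p\<in>insert q P. c p * x p) = 0" for c
          using z(3) that q0[OF that] insert.hyps by simp
        then show ?thesis
          using z(1,2) A0 by (intro exI[of _ "z(q := 0)"]) (simp only: z'_sum, simp)
      qed
    qed
  qed
  then show ?thesis using that by blast
qed

section \<open>Selecting a basis from a finite family\<close>

text \<open>A spanning subfamily of least cardinality is independent, since a nontrivial relation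
  would allow one member to be dropped. Vectors are compared only on \<open>X\<close>.\<close>

lemma exists_basis_family:
  fixes u :: "'l \<Rightarrow> 'i \<Rightarrow> 'a::field"
  assumes "finite L"
  obtains P C where "P \<subseteq> L"
    and "\<And>l i. l \<in> L \<Longrightarrow> i \<in> X \<Longrightarrow> u l i = (\<Sum>p\<in>P. C l p * u p i)"
    and "\<And>p q. p \<in> P \<Longrightarrow> C p q = (if q = p then 1 else 0)"
    and "\<And>d p. (\<And>i. i \<in> X \<Longrightarrow> (\<Sum>p\<in>P. d p * u p i) = 0) \<Longrightarrow> p \<in> P \<Longrightarrow> d p = 0"
proof -
  define spans where
    "spans P \<longleftrightarrow> P \<subseteq> L \<and> (\<forall>l\<in>L. \<exists>c. \<forall>i\<in>X. u l i = (\<Sum>p\<in>P. c p * u p i))" for P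
  have delta: "(\<Sum>p\<in>P. (if p = l then 1 else 0) * u p i) = u l i" if "P \<subseteq> L" "l \<in> P" for P l i
  proof -
    have "finite P" using that assms finite_subset by auto
    have "(\<Sum>p\<in>P. (if p = l then 1 else 0) * u p i) = (\<Sum>p\<in>P. if p = l then u p i else 0)"
      by (rule sum.cong) auto
    then show ?thesis using \<open>finite P\<close> that by simp
  qed
  have "spans L"
    unfolding spans_def
  proof (intro conjI ballI)
    fix l assume "l \<in> L"
    show "\<exists>c. \<forall>i\<in>X. u l i = (\<Sum>p\<in>L. c p * u p i)"
      by (intro exI[of _ "\<lambda>p. if p = l then 1 else 0"] ballI)
         (rule delta[OF order_refl \<open>l \<in> L\<close>, symmetric])
  qed simp
  then obtain P where P: "spans P" and min: "\<And>Q. spans Q \<Longrightarrow> card P \<le> card Q"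
    using ex_has_least_nat[of spans L card] by blast
  have "P \<subseteq> L" using P by (simp add: spans_def)
  then have "finite P" using assms finite_subset by auto
  obtain C where C: "\<And>l i. l \<in> L \<Longrightarrow> i \<in> X \<Longrightarrow> u l i = (\<Sum>p\<in>P. C l p * u p i)"
    using P unfolding spans_def by metis
  \<comment> \<open>Basis members receive 0-1 coordinates, so only vectors outside \<open>P\<close>
    will contribute parameters.\<close>
  define C' where "C' l = (if l \<in> P then (\<lambda>q. if q = l then 1 else 0) else C l)" for l
  show ?thesis
  proof (rule that[OF \<open>P \<subseteq> L\<close>])
    show "u l i = (\<Sum>p\<in>P. C' l p * u p i)" if "l \<in> L" "i \<in> X" for l i
      using C[OF that] delta[OF \<open>P \<subseteq> L\<close>, of l i] by (simp add: C'_def)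
    show "C' p q = (if q = p then 1 else 0)" if "p \<in> P" for p q
      using that by (simp add: C'_def)
    show "d p = 0" if d: "\<And>i. i \<in> X \<Longrightarrow> (\<Sum>p\<in>P. d p * u p i) = 0" and "p \<in> P" for d p
    proof (rule ccontr)
      assume "d p \<noteq> 0"
      \<comment> \<open>Subtracting \<open>C l p / d p\<close> times the relation \<open>d\<close>
        makes the coefficient at \<open>p\<close> zero.\<close>
      have "u l i = (\<Sum>q\<in>P - {p}. (C l q - C l p * d q / d p) * u q i)" if "l \<in> L" "i \<in> X" for l i
      proof -
        have "u l i = (\<Sum>q\<in>P. C l q * u q i) - C l p / d p * (\<Sum>q\<in>P. d q * u q i)"
          using C[OF that] d[OF that(2)] by simp
        also have "\<dots> = (\<Sum>q\<in>P. (C l q - C l p * d q / d p) * u q i)"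
          by (simp add: left_diff_distrib sum_subtractf sum_distrib_left mult.assoc)
        also have "\<dots> = (\<Sum>q\<in>P - {p}. (C l q - C l p * d q / d p) * u q i)"
          by (rule sum.mono_neutral_right) (use \<open>finite P\<close> \<open>d p \<noteq> 0\<close> in auto)
        finally show ?thesis .
      qed
      then have "spans (P - {p})"
        unfolding spans_def using \<open>P \<subseteq> L\<close> by (meson Diff_subset order_trans)
      from min[OF this] show False
        using \<open>finite P\<close> \<open>p \<in> P\<close> by (metis card_Diff1_less not_le)
    qed
  qed
qed

section \<open>Factorizations of Euclidean distance matrices\<close>

text \<open>Three squares with distinct centers form a basis of the polynomials of degree at most 2;
  the coefficients are explicit, with Vandermonde denominator \<open>V\<close>.\<close>

lemma quadratic_in_span_of_squares:
  fixes a b c A B C :: real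
  assumes "a \<noteq> b" "a \<noteq> c" "b \<noteq> c"
  obtains p q r where
    "\<And>t. p * (t - a)\<^sup>2 + q * (t - b)\<^sup>2 + r * (t - c)\<^sup>2 = A * t\<^sup>2 + B * t + C"
proof -
  define V where "V = (a - b) * (a - c) * (b - c)"
  \<comment> \<open>The polar form of the target quadratic. For \<open>(t - a)\<^sup>2\<close> it is
    \<open>(x - a) * (y - a)\<close>, so evaluation at \<open>b\<close> and \<open>c\<close> kills
    the squares centered there and isolates the coefficient of the one centered at
    \<open>a\<close>.\<close>
  define M where "M x y = C + B / 2 * (x + y) + A * x * y" for x y
  have "V \<noteq> 0" using assms by (simp add: V_def)
  have eq: "M b c * (b - c) * (t - a)\<^sup>2 - M a c * (a - c) * (t - b)\<^sup>2 + M a b * (a - b) * (t - c)\<^sup>2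
      = (A * t\<^sup>2 + B * t + C) * V" for t
    by (simp add: M_def V_def field_simps power2_eq_square)
  have "M b c * (b - c) / V * (t - a)\<^sup>2 + - (M a c * (a - c) / V) * (t - b)\<^sup>2
      + M a b * (a - b) / V * (t - c)\<^sup>2 = A * t\<^sup>2 + B * t + C" for t
  proof -
    have "M b c * (b - c) / V * (t - a)\<^sup>2 + - (M a c * (a - c) / V) * (t - b)\<^sup>2
        + M a b * (a - b) / V * (t - c)\<^sup>2
      = (M b c * (b - c) * (t - a)\<^sup>2 - M a c * (a - c) * (t - b)\<^sup>2 + M a b * (a - b) * (t - c)\<^sup>2) / V"
      by (simp add: diff_divide_distrib add_divide_distrib)
    also have "\<dots> = A * t\<^sup>2 + B * t + C"
      using \<open>V \<noteq> 0\<close> by (simp add: eq)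
    finally show ?thesis .
  qed
  then show ?thesis by (rule that)
qed

text \<open>Columns 0, 1 and 2 of the matrix are combinations of the \<open>u l\<close>, and they
  are squares with distinct centers, so they yield every quadratic in
  \<open>\<alpha> i\<close>.\<close>

lemma quadratic_in_factor_span:
  assumes "alg_indep_rat n \<alpha>" "n \<ge> 3"
    and fact: "\<And>i j. i < n \<Longrightarrow> j < n \<Longrightarrow> edm \<alpha> i j = (\<Sum>l<k. u l i * v l j)"
  obtains w where "\<And>i. i < n \<Longrightarrow> A * (\<alpha> i)\<^sup>2 + B * \<alpha> i + C = (\<Sum>l<k. w l * u l i)"
proof -
  have "\<alpha> 0 \<noteq> \<alpha> 1" "\<alpha> 0 \<noteq> \<alpha> 2" "\<alpha> 1 \<noteq> \<alpha> 2"
    using alg_indep_rat_inj[OF assms(1), of 0 1] alg_indep_rat_inj[OF assms(1), of 0 2]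
      alg_indep_rat_inj[OF assms(1), of 1 2] assms(2) by simp_all
  then obtain p q r where pqr:
    "\<And>t. p * (t - \<alpha> 0)\<^sup>2 + q * (t - \<alpha> 1)\<^sup>2 + r * (t - \<alpha> 2)\<^sup>2 = A * t\<^sup>2 + B * t + C"
    by (rule quadratic_in_span_of_squares[where A = A and B = B and C = C]) blast
  have "A * (\<alpha> i)\<^sup>2 + B * \<alpha> i + C = (\<Sum>l<k. (p * v l 0 + q * v l 1 + r * v l 2) * u l i)"
    if "i < n" for i
  proof -
    have "A * (\<alpha> i)\<^sup>2 + B * \<alpha> i + C = p * edm \<alpha> i 0 + q * edm \<alpha> i 1 + r * edm \<alpha> i 2"
      using pqr[of "\<alpha> i"] by (simp add: edm_def)
    also have "\<dots> = (\<Sum>l<k. (p * v l 0 + q * v l 1 + r * v l 2) * u l i)"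
      using assms(2) that by (simp add: fact sum_distrib_left sum.distrib algebra_simps)
    finally show ?thesis .
  qed
  then show ?thesis by (rule that)
qed

lemma sum_mult_sum_swap:
  fixes w :: "'l \<Rightarrow> 'a::comm_semiring_0"
  shows "(\<Sum>l\<in>L. w l * (\<Sum>p\<in>P. C l p * x p)) = (\<Sum>p\<in>P. (\<Sum>l\<in>L. w l * C l p) * x p)"
  by (simp add: sum_distrib_left sum_distrib_right mult.assoc) (rule sum.swap)

section \<open>Counting the parameters of a factorization\<close>

lemma normalized_factorization_bound:
  assumes indep: "alg_indep_rat n \<alpha>" and n3: "n \<ge> 3"
    and fact: "\<And>i j. i < n \<Longrightarrow> j < n \<Longrightarrow> edm \<alpha> i j = (\<Sum>l<k. u l i * v l j)"
    and disj: "\<And>i l. i < n \<Longrightarrow> l < k \<Longrightarrow> u l i * v l i = 0"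
    and Z: "Z \<subseteq> {..<k}" "\<And>i. i < n \<Longrightarrow> (\<Sum>l\<in>Z. u l i) = 1"
  shows "4 * n \<le> (k + 2)\<^sup>2"
proof -
  obtain P C where P: "P \<subseteq> {..<k}"
    and C: "\<And>l i. l \<in> {..<k} \<Longrightarrow> i \<in> {..<n} \<Longrightarrow> u l i = (\<Sum>p\<in>P. C l p * u p i)"
    and C1: "\<And>p q. p \<in> P \<Longrightarrow> C p q = (if q = p then 1 else 0)"
    and ind: "\<And>d p. (\<And>i. i \<in> {..<n} \<Longrightarrow> (\<Sum>p\<in>P. d p * u p i) = 0) \<Longrightarrow> p \<in> P \<Longrightarrow> d p = 0"
    by (rule exists_basis_family[where L = "{..<k}" and u = u and X = "{..<n}"]) auto
  have "finite P" using P finite_subset by auto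
  have comb: "(\<Sum>l\<in>L. w l * u l i) = (\<Sum>p\<in>P. (\<Sum>l\<in>L. w l * C l p) * u p i)"
    if "i < n" "L \<subseteq> {..<k}" for w L i
  proof -
    have "(\<Sum>l\<in>L. w l * u l i) = (\<Sum>l\<in>L. w l * (\<Sum>p\<in>P. C l p * u p i))"
      by (rule sum.cong) (use that C in auto)
    then show ?thesis by (simp only: sum_mult_sum_swap)
  qed
  have "\<exists>a. \<forall>i<n. A * (\<alpha> i)\<^sup>2 + B * \<alpha> i + D = (\<Sum>p\<in>P. a p * u p i)" for A B D
  proof -
    obtain w where w: "\<And>i. i < n \<Longrightarrow> A * (\<alpha> i)\<^sup>2 + B * \<alpha> i + D = (\<Sum>l<k. w l * u l i)"
      using quadratic_in_factor_span[OF indep n3 fact] by blast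
    show ?thesis
      by (rule exI[of _ "\<lambda>p. \<Sum>l<k. w l * C l p"]) (use w comb in simp)
  qed
  note comb_quad = this
  obtain a where a: "\<And>i. i < n \<Longrightarrow> (\<alpha> i)\<^sup>2 = (\<Sum>p\<in>P. a p * u p i)"
    using comb_quad[of 1 0 0] by auto
  obtain b where b: "\<And>i. i < n \<Longrightarrow> \<alpha> i = (\<Sum>p\<in>P. b p * u p i)"
    using comb_quad[of 0 1 0] by auto
  \<comment> \<open>Coordinates of the constant function: sums of entries of \<open>C\<close>, hence
    already in the ring without parameters of their own.\<close>
  define g where "g p = (\<Sum>l\<in>Z. C l p)" for p
  have g: "(\<Sum>p\<in>P. g p * u p i) = 1" if "i < n" for i
    using comb[OF that Z(1), of "\<lambda>_. 1"] Z(2)[OF that] by (simp add: g_def)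
  \<comment> \<open>One block of size \<open>card P\<close> for each \<open>l\<close> outside
    \<open>P\<close>, and two more, tagged \<open>k\<close> and \<open>Suc k\<close>, for
    \<open>a\<close> and \<open>b\<close>.\<close>
  define I where "I = P \<times> (({..<k} - P) \<union> {k, Suc k})"
  define y where "y = (\<lambda>(p, l). if l < k then C l p else if l = k then a p else b p)"
  have "finite I" using \<open>finite P\<close> by (simp add: I_def)
  have CR: "C l p \<in> rat_polys y I" if "l < k" "p \<in> P" for l p
  proof (cases "l \<in> P")
    case True
    then show ?thesis by (simp add: C1 rat_polys_0 rat_polys_1)
  next
    case False
    then show ?thesis
      using rat_polys_var[OF \<open>finite I\<close>, of "(p, l)" y] that by (simp add: I_def y_def)
  qed
  have aR: "a p \<in> rat_polys y I" and bR: "b p \<in> rat_polys y I" if "p \<in> P" for p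
    using rat_polys_var[OF \<open>finite I\<close>, of "(p, k)" y]
      rat_polys_var[OF \<open>finite I\<close>, of "(p, Suc k)" y] that by (simp_all add: I_def y_def)
  have gR: "g p \<in> rat_polys y I" if "p \<in> P" for p
    unfolding g_def using Z(1) that by (intro rat_polys_sum CR) auto
  have "n \<le> card I"
  proof (rule alg_indep_rat_le_card[OF indep \<open>finite I\<close>])
    fix i assume "i < n"
    have "(\<Sum>p\<in>P. g p * u p i) \<noteq> 0"
      using g[OF \<open>i < n\<close>] by simp
    \<comment> \<open>\<open>z\<close> stands in for the point with coordinates
      \<open>u p i\<close>, inheriting all its linear relations over the ring while keeping
      \<open>g\<close> nonzero.\<close>
    then obtain z where zR: "\<And>p. p \<in> P \<Longrightarrow> z p \<in> rat_polys y I"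
      and gz: "(\<Sum>p\<in>P. g p * z p) \<noteq> 0"
      and rel: "\<And>c. (\<And>p. p \<in> P \<Longrightarrow> c p \<in> rat_polys y I) \<Longrightarrow> (\<Sum>p\<in>P. c p * u p i) = 0
                  \<Longrightarrow> (\<Sum>p\<in>P. c p * z p) = 0"
      using subring_solution_of_linear_system[where A = "rat_polys y I" and P = P and g = g
          and x = "\<lambda>p. u p i", OF rat_polys_0 rat_polys_1 rat_polys_add rat_polys_mult
          rat_polys_uminus \<open>finite P\<close> gR] by blast
    \<comment> \<open>Column \<open>i\<close> is expanded in the basis in two ways, by the
      factorization and by the squared difference. Independence equates the coordinates, so the
      identity can be evaluated at \<open>z\<close> too.\<close>
    have "(\<Sum>l<k. v l i * C l p) - (a p - 2 * \<alpha> i * b p + (\<alpha> i)\<^sup>2 * g p) = 0" if "p \<in> P" for p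
    proof (rule ind[OF _ that])
      fix j assume "j \<in> {..<n}"
      then have "j < n" by simp
      have "(\<Sum>p\<in>P. ((\<Sum>l<k. v l i * C l p) - (a p - 2 * \<alpha> i * b p + (\<alpha> i)\<^sup>2 * g p)) * u p j)
         = (\<Sum>l<k. v l i * u l j) - ((\<Sum>p\<in>P. a p * u p j) - 2 * \<alpha> i * (\<Sum>p\<in>P. b p * u p j)
             + (\<alpha> i)\<^sup>2 * (\<Sum>p\<in>P. g p * u p j))"
        unfolding comb[OF \<open>j < n\<close> order_refl]
        by (simp add: left_diff_distrib distrib_right sum_subtractf sum.distrib sum_distrib_left mult.assoc)
      also have "\<dots> = edm \<alpha> j i - ((\<alpha> j)\<^sup>2 - 2 * \<alpha> i * \<alpha> j + (\<alpha> i)\<^sup>2)"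
        using fact[OF \<open>j < n\<close> \<open>i < n\<close>] a[OF \<open>j < n\<close>] b[OF \<open>j < n\<close>] g[OF \<open>j < n\<close>]
        by (simp add: mult.commute)
      also have "\<dots> = 0"
        by (simp add: edm_def power2_diff)
      finally show "(\<Sum>p\<in>P. ((\<Sum>l<k. v l i * C l p)
          - (a p - 2 * \<alpha> i * b p + (\<alpha> i)\<^sup>2 * g p)) * u p j) = 0" .
    qed
    then have "(\<Sum>p\<in>P. (\<Sum>l<k. v l i * C l p) * z p)
        = (\<Sum>p\<in>P. (a p - 2 * \<alpha> i * b p + (\<alpha> i)\<^sup>2 * g p) * z p)"
      by (intro sum.cong) auto
    also have "\<dots> = (\<Sum>p\<in>P. a p * z p) - 2 * \<alpha> i * (\<Sum>p\<in>P. b p * z p)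
        + (\<alpha> i)\<^sup>2 * (\<Sum>p\<in>P. g p * z p)"
      by (simp add: left_diff_distrib distrib_right sum_subtractf sum.distrib sum_distrib_left mult.assoc)
    finally have eq: "(\<Sum>l<k. v l i * (\<Sum>p\<in>P. C l p * z p)) = \<dots>"
      by (simp only: sum_mult_sum_swap)
    \<comment> \<open>The numbers \<open>v l i\<close> need not lie in the ring, so relations are
      transferred one \<open>l\<close> at a time: \<open>v l i \<noteq> 0\<close> forces
      \<open>u l i = 0\<close>, a relation with coefficients in the ring.\<close>
    have "v l i * (\<Sum>p\<in>P. C l p * z p) = 0" if "l < k" for l
    proof (cases "v l i = 0")
      case False
      then have "(\<Sum>p\<in>P. C l p * u p i) = 0"
        using disj[OF \<open>i < n\<close> that] C[of l i] that \<open>i < n\<close> by simp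
      then show ?thesis
        using rel[of "C l"] CR[OF that] by simp
    qed simp
    then have "(\<Sum>l<k. v l i * (\<Sum>p\<in>P. C l p * z p)) = 0"
      by (intro sum.neutral) simp
    \<comment> \<open>The factor 2 is written as a sum so that closure of the ring under addition
      suffices.\<close>
    with eq have "(\<Sum>p\<in>P. g p * z p) * (\<alpha> i)\<^sup>2
        = ((\<Sum>p\<in>P. b p * z p) + (\<Sum>p\<in>P. b p * z p)) * \<alpha> i + - (\<Sum>p\<in>P. a p * z p)"
      by (simp only: algebra_simps)
    moreover have "(\<Sum>p\<in>P. g p * z p) \<in> rat_polys y I"
      "(\<Sum>p\<in>P. b p * z p) + (\<Sum>p\<in>P. b p * z p) \<in> rat_polys y I"
      "- (\<Sum>p\<in>P. a p * z p) \<in> rat_polys y I"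
      by (intro rat_polys_uminus rat_polys_add rat_polys_sum rat_polys_mult aR bR gR zR; assumption)+
    ultimately show "\<exists>A\<in>rat_polys y I. \<exists>B\<in>rat_polys y I. \<exists>C\<in>rat_polys y I.
                 A \<noteq> 0 \<and> A * (\<alpha> i)\<^sup>2 = B * \<alpha> i + C"
      using gz by blast
  qed
  also have "card I = card P * (k - card P + 2)"
  proof -
    have "card (({..<k} - P) \<union> {k, Suc k}) = card ({..<k} - P) + card {k, Suc k}"
      by (rule card_Un_disjoint) auto
    then show ?thesis
      using P \<open>finite P\<close> by (simp add: I_def card_cartesian_product card_Diff_subset)
  qed
  finally have "n \<le> card P * (k - card P + 2)" .
  moreover have "card P \<le> k"
    using card_mono[OF _ P] by simp
  then obtain m where m: "k = card P + m"
    using le_Suc_ex by blast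
  ultimately have "4 * n \<le> 4 * (card P * (m + 2))"
    by simp
  also have "\<dots> \<le> (k + 2)\<^sup>2"
  proof -
    \<comment> \<open>The difference of the two sides is the square of
      \<open>card P - (m + 2)\<close>, taken in the integers to avoid truncated subtraction.\<close>
    have "int (4 * (card P * (m + 2))) \<le> int ((card P + m + 2)\<^sup>2)"
      using zero_le_power2[of "int (card P) - (int m + 2)"]
      by (simp add: power2_eq_square algebra_simps)
    then show ?thesis by (simp only: of_nat_le_iff m)
  qed
  finally show ?thesis .
qed

text \<open>Rescaling the rank-one terms makes the coefficients that express the constant function
  through the \<open>u l\<close> equal to 0 or 1, so they contribute no transcendental parameters.\<close>

lemma factorization_bound:
  assumes indep: "alg_indep_rat n \<alpha>" and n3: "n \<ge> 3"
    and fact: "\<And>i j. i < n \<Longrightarrow> j < n \<Longrightarrow> edm \<alpha> i j = (\<Sum>l<k. u l i * v l j)"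
    and disj: "\<And>i l. i < n \<Longrightarrow> l < k \<Longrightarrow> u l i * v l i = 0"
  shows "4 * n \<le> (k + 2)\<^sup>2"
proof -
  obtain w where w: "\<And>i. i < n \<Longrightarrow> 0 * (\<alpha> i)\<^sup>2 + 0 * \<alpha> i + 1 = (\<Sum>l<k. w l * u l i)"
    using quadratic_in_factor_span[OF indep n3 fact] by blast
  \<comment> \<open>The default 1 keeps every scale invertible; terms with \<open>w l = 0\<close>
    are left out of \<open>Z\<close>.\<close>
  define s where "s l = (if w l = 0 then 1 else w l)" for l
  have s: "s l \<noteq> 0" for l by (simp add: s_def)
  show ?thesis
  proof (rule normalized_factorization_bound[OF indep n3, where Z = "{l\<in>{..<k}. w l \<noteq> 0}"])
    show "edm \<alpha> i j = (\<Sum>l<k. (s l * u l i) * (v l j / s l))" if "i < n" "j < n" for i j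
      using fact[OF that] s by simp
    show "(s l * u l i) * (v l i / s l) = 0" if "i < n" "l < k" for i l
      using disj[OF that] s by simp
    show "(\<Sum>l\<in>{l\<in>{..<k}. w l \<noteq> 0}. s l * u l i) = 1" if "i < n" for i
    proof -
      have "(\<Sum>l\<in>{l\<in>{..<k}. w l \<noteq> 0}. s l * u l i) = (\<Sum>l<k. w l * u l i)"
        by (rule sum.mono_neutral_cong_left) (auto simp: s_def)
      then show ?thesis using w[OF that] by simp
    qed
  qed auto
qed

section \<open>From factorizations to the nonnegative rank\<close>

text \<open>The least \<open>k\<close> is attained because some factorization exists: the identity
  matrix times \<open>A\<close> has \<open>n\<close> terms.\<close>

lemma nonneg_fact_nonneg_rank:
  assumes "\<And>i j. i < n \<Longrightarrow> j < m \<Longrightarrow> A i j \<ge> 0"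
  shows "nonneg_fact n m A (nonneg_rank n m A)"
proof -
  have "A i j = (\<Sum>l<n. (if l = i then 1 else 0) * A l j)" if "i < n" for i j
  proof -
    have "(\<Sum>l<n. (if l = i then 1 else 0) * A l j) = (\<Sum>l<n. if l = i then A l j else 0)"
      by (rule sum.cong) auto
    then show ?thesis using that by simp
  qed
  then have "nonneg_fact n m A n"
    unfolding nonneg_fact_def using assms
    by (intro exI[of _ "\<lambda>l i. if l = i then 1 else 0"] exI[of _ A]) auto
  then show ?thesis
    unfolding nonneg_rank_def by (rule LeastI)
qed

theorem theorem1:
  fixes n :: nat and \<alpha> :: "nat \<Rightarrow> real"
  assumes "n \<ge> 3"
    and "alg_indep_rat n \<alpha>"
  shows "real (nonneg_rank n n (edm \<alpha>)) \<ge> 2 * sqrt (real n) - 2"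
proof -
  define k where "k = nonneg_rank n n (edm \<alpha>)"
  have "nonneg_fact n n (edm \<alpha>) k"
    unfolding k_def by (rule nonneg_fact_nonneg_rank) (simp add: edm_def)
  then obtain u v where uv: "\<forall>l<k. \<forall>i<n. u l i \<ge> 0" "\<forall>l<k. \<forall>j<n. v l j \<ge> 0"
    and fact: "\<forall>i<n. \<forall>j<n. edm \<alpha> i j = (\<Sum>l<k. u l i * v l j)"
    unfolding nonneg_fact_def by blast
  \<comment> \<open>Here nonnegativity enters: a zero diagonal entry is a sum of nonnegative terms,
    so each term vanishes.\<close>
  have "u l i * v l i = 0" if "i < n" "l < k" for i l
  proof -
    have "(\<Sum>l<k. u l i * v l i) = 0"
      using fact that by (metis diff_self edm_def power_zero_numeral)
    then show ?thesis
      using that uv by (subst (asm) sum_nonneg_eq_0_iff) auto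
  qed
  then have "4 * n \<le> (k + 2)\<^sup>2"
    using fact by (intro factorization_bound[OF assms(2,1)]) auto
  then have "real (4 * n) \<le> real ((k + 2)\<^sup>2)"
    by (simp only: of_nat_le_iff)
  then have "sqrt (4 * real n) \<le> real k + 2"
    by (intro real_le_lsqrt) (simp_all add: add.commute)
  then show ?thesis
    by (simp add: real_sqrt_mult k_def)
qed

end
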